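(* Let $G$ be a signed digraph. If the positive feedback number of $G$ is at most one, then $G$ is separating.
   Context: A signed digraph $G=(V,E)$ has finite vertex set $V$ and arcs $E\subseteq V\times V\times\{-1,1\}$ ($(j,i,s)$: arc from $j$ to $i$ of sign $s$; loops and opposite-sign parallel arcs allowed). Cycles are simple; the sign of a cycle is the product of its arc signs. A positive feedback vertex set is a set $I\subseteq V$ such that $G\setminus I$ (the subgraph induced by $V\setminus I$) has no positive cycle; the positive feedback number is the minimum size of such a set. A BN on $V$ is a map $f:\{0,1\}^V\to\{0,1\}^V$; $G(f)$ has a positive (negative) arc from $j$ to $i$ iff for some $x$ with $x_j=0$, $f_i(x+e_j)-f_i(x)$ is positive (negative), $e_j$ being the configuration equal to $1$ only at $j$ and $+$ addition mod 2. $F(G)=\{f:G(f)=G\}$. $\Gamma(f)$ is the digraph on $\{0,1\}^V$ with an arc $x\to x+e_i$ whenever $f_i(x)\neq x_i$. Attractors are inclusion-minimal nonempty sets with no outgoing arc. A subspace is a set $\{x: x_i=c(i)\ \forall i\in I\}$; $[X]$ is the smallest subspace containing $X$. $G$ is separating if for every $f\in F(G)$ and distinct attractors $A,B$ of $\Gamma(f)$, $[A]\cap[B]=\emptyset$. *)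

theory Defs
  imports "Graph_Theory.Graph_Theory" "HOL-Library.FuncSet"
begin

text \<open>
  An arc is a triple \<open>(j, i, s)\<close>: source, target, sign. Signed digraphs are
  library digraphs whose tail and head maps are the first two projections, so that
  induced subgraphs and (simple) cycles are the library's. A loop is a cycle of
  length one; cycles are lists of arcs, so opposite-sign parallel arcs give
  different cycles.
\<close>

type_synonym 'v sdigraph = "('v, 'v \<times> 'v \<times> int) pre_digraph"

definition signed_digraph :: "'v sdigraph \<Rightarrow> bool" where
  "signed_digraph G \<longleftrightarrow> finite (verts G) \<and> arcs G \<subseteq> verts G \<times> verts G \<times> {-1, 1}
     \<and> tail G = fst \<and> head G = fst \<circ> snd"

definition arc_list_sign :: "('v \<times> 'v \<times> int) list \<Rightarrow> int" where
  "arc_list_sign p = (\<Prod>(j, i, s)\<leftarrow>p. s)"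

definition positive_cycle :: "'v sdigraph \<Rightarrow> ('v \<times> 'v \<times> int) list \<Rightarrow> bool" where
  "positive_cycle G p \<longleftrightarrow> pre_digraph.cycle G p \<and> arc_list_sign p = 1"

definition positive_fvs :: "'v sdigraph \<Rightarrow> 'v set \<Rightarrow> bool" where
  "positive_fvs G I \<longleftrightarrow> I \<subseteq> verts G \<and> (\<nexists>p. positive_cycle (G \<restriction> (verts G - I)) p)"

definition positive_feedback_number :: "'v sdigraph \<Rightarrow> nat" where
  "positive_feedback_number G = Min (card ` {I. positive_fvs G I})"

text \<open>
  \<open>False\<close> and \<open>True\<close> stand for 0 and 1. Configurations are extensional, i.e. they
  carry no information outside \<open>V\<close>.
\<close>

definition configs :: "'v set \<Rightarrow> ('v \<Rightarrow> bool) set" where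
  "configs V = V \<rightarrow>\<^sub>E UNIV"

text \<open>\<open>flip x j\<close> is \<open>x + e\<^sub>j\<close>.\<close>

definition flip :: "('v \<Rightarrow> bool) \<Rightarrow> 'v \<Rightarrow> 'v \<Rightarrow> bool" where
  "flip x j = x(j := \<not> x j)"

definition interaction_graph :: "'v set \<Rightarrow> (('v \<Rightarrow> bool) \<Rightarrow> ('v \<Rightarrow> bool)) \<Rightarrow> 'v sdigraph" where
  "interaction_graph V f =
     \<lparr> verts = V,
       arcs = {(j, i, s). j \<in> V \<and> i \<in> V \<and> s \<in> {-1, 1} \<and>
         (\<exists>x\<in>configs V. \<not> x j \<and> sgn (of_bool (f (flip x j) i) - of_bool (f x i)) = s)},
       tail = fst, head = fst \<circ> snd \<rparr>"

definition BNs_on :: "'v sdigraph \<Rightarrow> (('v \<Rightarrow> bool) \<Rightarrow> ('v \<Rightarrow> bool)) set" where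
  "BNs_on G = {f \<in> configs (verts G) \<rightarrow> configs (verts G). interaction_graph (verts G) f = G}"

text \<open>The arc relation of \<open>\<Gamma>(f)\<close>.\<close>

definition async_graph ::
    "'v set \<Rightarrow> (('v \<Rightarrow> bool) \<Rightarrow> ('v \<Rightarrow> bool)) \<Rightarrow> (('v \<Rightarrow> bool) \<times> ('v \<Rightarrow> bool)) set" where
  "async_graph V f = {(x, flip x i) | x i. x \<in> configs V \<and> i \<in> V \<and> f x i \<noteq> x i}"

definition trap_set :: "'v set \<Rightarrow> (('v \<Rightarrow> bool) \<Rightarrow> ('v \<Rightarrow> bool)) \<Rightarrow> ('v \<Rightarrow> bool) set \<Rightarrow> bool" where
  "trap_set V f A \<longleftrightarrow> A \<noteq> {} \<and> A \<subseteq> configs V \<and> (\<forall>(x, y)\<in>async_graph V f. x \<in> A \<longrightarrow> y \<in> A)"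

definition attractor :: "'v set \<Rightarrow> (('v \<Rightarrow> bool) \<Rightarrow> ('v \<Rightarrow> bool)) \<Rightarrow> ('v \<Rightarrow> bool) set \<Rightarrow> bool" where
  "attractor V f A \<longleftrightarrow> trap_set V f A \<and> (\<nexists>B. trap_set V f B \<and> B \<subset> A)"

definition config_subspace :: "'v set \<Rightarrow> ('v \<Rightarrow> bool) set \<Rightarrow> bool" where
  "config_subspace V S \<longleftrightarrow> (\<exists>I c. I \<subseteq> V \<and> S = {x \<in> configs V. \<forall>i\<in>I. x i = c i})"

text \<open>\<open>[X]\<close>; for nonempty \<open>X\<close> the hull is itself a subspace, as shown below.\<close>

definition spanned_subspace :: "'v set \<Rightarrow> ('v \<Rightarrow> bool) set \<Rightarrow> ('v \<Rightarrow> bool) set" where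
  "spanned_subspace V X = config_subspace V hull X"

definition separating :: "'v sdigraph \<Rightarrow> bool" where
  "separating G \<longleftrightarrow> (\<forall>f\<in>BNs_on G. \<forall>A B.
     attractor (verts G) f A \<and> attractor (verts G) f B \<and> A \<noteq> B \<longrightarrow>
     spanned_subspace (verts G) A \<inter> spanned_subspace (verts G) B = {})"

lemma config_subspace_spanned:
  assumes "X \<noteq> {}" "X \<subseteq> configs V"
  shows "config_subspace V (spanned_subspace V X)"
proof -
  obtain a where a: "a \<in> X" using assms(1) by auto
  define I where "I = {i \<in> V. \<forall>x\<in>X. x i = a i}"
  define S where "S = {x \<in> configs V. \<forall>i\<in>I. x i = a i}"
  have IV: "I \<subseteq> V" by (simp add: I_def)
  have S: "config_subspace V S"
    unfolding config_subspace_def by (intro exI[of _ I] exI[of _ a] conjI IV S_def)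
  have XS: "X \<subseteq> S"
  proof
    fix x assume "x \<in> X"
    then show "x \<in> S" using subsetD[OF assms(2)] by (simp add: S_def I_def)
  qed
  have ST: "S \<subseteq> T" if T: "X \<subseteq> T" "config_subspace V T" for T
  proof
    fix x assume x: "x \<in> S"
    from T(2) obtain J c where J: "J \<subseteq> V" "T = {x \<in> configs V. \<forall>i\<in>J. x i = c i}"
      unfolding config_subspace_def by (elim exE conjE)
    have c: "y i = c i" if "y \<in> X" "i \<in> J" for y i
      using subsetD[OF T(1) that(1)] that(2) by (simp add: J(2))
    have "x i = c i" if i: "i \<in> J" for i
    proof -
      have "i \<in> I" using subsetD[OF J(1) i] by (simp add: I_def c[OF _ i] c[OF a i])
      then have "x i = a i" using x by (simp add: S_def)
      then show ?thesis using c[OF a i] by simp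
    qed
    then show "x \<in> T" using x by (simp add: J(2) S_def)
  qed
  have "spanned_subspace V X = S"
    unfolding spanned_subspace_def using XS S ST by (rule hull_unique)
  then show ?thesis using S by simp
qed

lemma positive_fvs_verts: "positive_fvs G (verts G)"
  unfolding positive_fvs_def positive_cycle_def pre_digraph.cycle_def pre_digraph.awalk_def
  by simp

end

theory Submission
  imports Defs
begin

text \<open>
  Let \<open>I\<close> be a positive feedback vertex set and \<open>A\<close>, \<open>B\<close> disjoint trap sets. Suppose that some
  \<open>x \<in> A\<close> and \<open>y \<in> B\<close> agree on \<open>I\<close>, choose such a pair at minimal Hamming distance, and let \<open>D\<close> be
  the set of components where they differ. By minimality \<open>f\<close> fixes \<open>x\<close> and \<open>y\<close> on \<open>D\<close>. Moving from
  \<open>x\<close> to \<open>y\<close> one component at a time changes \<open>f\<^sub>i\<close> for every \<open>i \<in> D\<close>, so \<open>i\<close> has an in-neighbour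
  \<open>j \<in> D\<close> by an arc of sign \<open>\<sigma>\<^sub>j \<sigma>\<^sub>i\<close>, where \<open>\<sigma>\<^sub>k = \<plusminus>1\<close> is the sign of \<open>y\<^sub>k - x\<^sub>k\<close>. Following in-neighbours
  backwards yields a cycle inside \<open>D\<close>, and its sign is positive because every \<open>\<sigma>\<^sub>k\<close> occurs twice.
  This contradicts the choice of \<open>I\<close>. Hence all elements of \<open>A\<close> differ from all elements of \<open>B\<close>
  on \<open>I\<close>; when \<open>I = {i}\<close>, the component \<open>i\<close> is constant on \<open>A\<close> and takes the opposite value
  on \<open>B\<close>, which separates the spanned subspaces.
\<close>

lemma configs_iff: "x \<in> configs V \<longleftrightarrow> (\<forall>k. k \<notin> V \<longrightarrow> x k = undefined)"
  by (auto simp: configs_def PiE_def extensional_def)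

lemma flip_flip [simp]: "flip (flip x j) j = x"
  by (simp add: flip_def)

lemma flip_in_configs: "x \<in> configs V \<Longrightarrow> j \<in> V \<Longrightarrow> flip x j \<in> configs V"
  by (auto simp: configs_iff flip_def)

text \<open>Flip the components on which \<open>x\<close> and \<open>y\<close> differ one at a time
  until \<open>x\<close> becomes \<open>y\<close>: since \<open>P\<close> is two-valued, some single
  flip takes it from \<open>P x\<close> to \<open>P y\<close>. The clause \<open>z j = x j\<close>
  records the direction of that flip.\<close>

lemma exists_critical_flip:
  fixes P :: "('v \<Rightarrow> bool) \<Rightarrow> bool"
  assumes "finite D" "\<And>k. k \<notin> D \<Longrightarrow> x k = y k" "P x \<noteq> P y"
  shows "\<exists>z j. j \<in> D \<and> x j \<noteq> y j \<and> z j = x j \<and> (\<forall>k. k \<notin> D \<longrightarrow> z k = x k)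
    \<and> P z = P x \<and> P (flip z j) = P y"
  using assms
proof (induction D arbitrary: x rule: finite_induct)
  case empty
  then have "x = y" by auto
  with empty show ?case by simp
next
  case (insert d D)
  show ?case
  proof (cases "x d = y d")
    case True
    then have "\<And>k. k \<notin> D \<Longrightarrow> x k = y k" using insert.prems(1) by (metis insertE)
    from insert.IH[OF this insert.prems(2)] show ?thesis by auto
  next
    case d: False
    show ?thesis
    proof (cases "P (flip x d) = P y")
      case True
      with d show ?thesis by (intro exI[of _ x] exI[of _ d]) simp
    next
      case False
      have "\<And>k. k \<notin> D \<Longrightarrow> flip x d k = y k"
        using insert.prems(1) d by (auto simp: flip_def)
      from insert.IH[OF this False] obtain z j where z: "j \<in> D" "flip x d j \<noteq> y j"
        "z j = flip x d j" "\<forall>k. k \<notin> D \<longrightarrow> z k = flip x d k"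
        "P z = P (flip x d)" "P (flip z j) = P y" by auto
      have "j \<noteq> d" using z(1) insert.hyps by auto
      then have "x j \<noteq> y j" "z j = x j" using z(2,3) by (simp_all add: flip_def)
      moreover have "\<forall>k. k \<notin> insert d D \<longrightarrow> z k = x k" using z(4) by (simp add: flip_def)
      moreover have "P z = P x" using z(5) False insert.prems(2) by blast
      ultimately show ?thesis using z(1,6) by blast
    qed
  qed
qed

text \<open>Telescoping: each inner vertex of the walk contributes its \<open>\<sigma>\<close>
  twice, so only the two ends remain; a closed walk therefore has sign 1.\<close>

lemma arc_list_sign_balanced:
  fixes \<sigma> :: "'v \<Rightarrow> int"
  assumes "\<And>k. \<sigma> k * \<sigma> k = 1"
    and "\<And>j i s. (j, i, s) \<in> arcs H \<Longrightarrow> s = \<sigma> j * \<sigma> i"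
    and "tail H = fst" "head H = fst \<circ> snd"
    and "set p \<subseteq> arcs H" "pre_digraph.cas H u p v"
  shows "arc_list_sign p = \<sigma> u * \<sigma> v"
  using assms(5,6)
proof (induction p arbitrary: u)
  case Nil
  then show ?case by (simp add: arc_list_sign_def pre_digraph.cas.simps assms(1))
next
  case (Cons e p)
  obtain j i s where e: "e = (j, i, s)" by (cases e)
  have "arc_list_sign p = \<sigma> i * \<sigma> v" "u = j" "s = \<sigma> j * \<sigma> i"
    using Cons assms(2-4) by (auto simp: e pre_digraph.cas.simps)
  then have "arc_list_sign (e # p) = \<sigma> u * (\<sigma> i * \<sigma> i) * \<sigma> v"
    by (simp add: arc_list_sign_def e mult_ac)
  then show ?case by (simp add: assms(1))
qed

lemma (in wf_digraph) exists_cycle_if_in_arcs: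
  assumes "finite (verts G)" "verts G \<noteq> {}"
    and pred: "\<And>i. i \<in> verts G \<Longrightarrow> \<exists>j. j \<rightarrow> i"
  shows "\<exists>p. cycle p"
proof -
  have "arcs_ends G \<subseteq> verts G \<times> verts G" by auto
  then have fin: "finite (arcs_ends G)" using assms(1) finite_subset by blast
  \<comment> \<open>Being finite, an acyclic arc relation would be well-founded, and a minimal
    vertex would have no in-neighbour.\<close>
  have "\<not> acyclic (arcs_ends G)"
  proof
    assume "acyclic (arcs_ends G)"
    with fin have wf: "wf (arcs_ends G)" by (rule finite_acyclic_wf)
    obtain i where "i \<in> verts G" "\<And>j. j \<rightarrow> i \<Longrightarrow> j \<notin> verts G"
      using wfE_min[OF wf] assms(2) by (metis equals0I)
    with pred show False by (meson adj_in_verts(1))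
  qed
  then obtain u where "u \<rightarrow>\<^sup>+ u" by (auto simp: acyclic_def)
  then obtain p where "awalk u p u" "p \<noteq> []" by (auto simp: reachable1_awalk)
  then have "closed_w p" by (auto simp: closed_w_def)
  then show ?thesis by (rule closed_w_imp_cycle)
qed

lemma exists_positive_cycle_if_balanced:
  fixes \<sigma> :: "'v \<Rightarrow> int"
  assumes G: "signed_digraph G" and D: "D \<subseteq> verts G" "D \<noteq> {}"
    and \<sigma>: "\<And>k. \<sigma> k * \<sigma> k = 1"
    and pred: "\<And>i. i \<in> D \<Longrightarrow> \<exists>j\<in>D. (j, i, \<sigma> j * \<sigma> i) \<in> arcs G"
  shows "\<exists>p. positive_cycle (G \<restriction> D) p"
proof -
  \<comment> \<open>Only arcs of sign \<open>\<sigma> j * \<sigma> i\<close> are kept, so at most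
    one of two parallel arcs survives and every cycle of \<open>H\<close> is positive.\<close>
  define H where "H = \<lparr>verts = D,
    arcs = {(j, i, s). (j, i, s) \<in> arcs G \<and> j \<in> D \<and> i \<in> D \<and> s = \<sigma> j * \<sigma> i},
    tail = fst, head = fst \<circ> snd\<rparr>"
  have G_sel: "tail G = fst" "head G = fst \<circ> snd" using G by (auto simp: signed_digraph_def)
  interpret H: wf_digraph H by unfold_locales (auto simp: H_def)
  interpret GD: wf_digraph "G \<restriction> D"
    by unfold_locales (auto simp: induce_subgraph_def)
  have sub: "subgraph H (G \<restriction> D)"
    unfolding subgraph_def using H.wf_digraph GD.wf_digraph
    by (auto simp: H_def induce_subgraph_def compatible_def G_sel)
  have "finite D" using G D(1) by (auto simp: signed_digraph_def intro: finite_subset)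
  moreover have "\<exists>j. j \<rightarrow>\<^bsub>H\<^esub> i" if "i \<in> D" for i
  proof -
    from pred[OF that] obtain j where "j \<in> D" "(j, i, \<sigma> j * \<sigma> i) \<in> arcs G" by auto
    with that have "(j, i, \<sigma> j * \<sigma> i) \<in> arcs H" by (simp add: H_def)
    then have "j \<rightarrow>\<^bsub>H\<^esub> i" by (rule H.dominatesI[rotated]) (simp add: H_def arc_to_ends_def)
    then show ?thesis ..
  qed
  ultimately obtain p where p: "H.cycle p"
    using H.exists_cycle_if_in_arcs D(2) by (auto simp: H_def)
  then obtain u where "set p \<subseteq> arcs H" "H.cas u p u" by (auto simp: H.cycle_def H.awalk_def)
  then have "arc_list_sign p = \<sigma> u * \<sigma> u"
    by (intro arc_list_sign_balanced[where H = H] \<sigma>) (auto simp: H_def)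
  with \<sigma> GD.subgraph_cycle[OF sub p] show ?thesis by (auto simp: positive_cycle_def)
qed

text \<open>Carries a positive cycle found on a difference set over to the complement of a feedback
  set.\<close>

lemma positive_cycle_induced_mono:
  assumes "D \<subseteq> W" "positive_cycle (G \<restriction> D) p"
  shows "positive_cycle (G \<restriction> W) p"
proof -
  interpret W: wf_digraph "G \<restriction> W" by unfold_locales (auto simp: induce_subgraph_def)
  interpret D: wf_digraph "G \<restriction> D" by unfold_locales (auto simp: induce_subgraph_def)
  have "subgraph (G \<restriction> D) (G \<restriction> W)"
    unfolding subgraph_def using W.wf_digraph D.wf_digraph assms(1)
    by (auto simp: induce_subgraph_def compatible_def)
  with assms(2) show ?thesis by (auto simp: positive_cycle_def intro: W.subgraph_cycle)
qed

lemma trap_set_flip: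
  assumes "trap_set V f A" "x \<in> A" "i \<in> V" "f x i \<noteq> x i"
  shows "flip x i \<in> A"
proof -
  have "(x, flip x i) \<in> async_graph V f"
    using assms by (auto simp: async_graph_def trap_set_def)
  with assms(1,2) show ?thesis by (auto simp: trap_set_def)
qed

lemma attractors_disjoint:
  assumes "attractor V f A" "attractor V f B" "A \<noteq> B"
  shows "A \<inter> B = {}"
proof (rule ccontr)
  assume "A \<inter> B \<noteq> {}"
  then have "trap_set V f (A \<inter> B)"
    using assms(1,2) by (auto simp: attractor_def trap_set_def split_beta)
  then have "A \<inter> B = A" "A \<inter> B = B" using assms(1,2) unfolding attractor_def by blast+
  with assms(3) show False by simp
qed

lemma interaction_arc_of_flip:
  fixes y :: "'v \<Rightarrow> bool" and \<sigma> :: "'v \<Rightarrow> int"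
  defines "\<sigma> \<equiv> \<lambda>k. if y k then 1 else -1"
  assumes "j \<in> V" "i \<in> V" "z \<in> configs V"
    and "z j \<noteq> y j" "f z i \<noteq> y i" "f (flip z j) i = y i"
  shows "(j, i, \<sigma> j * \<sigma> i) \<in> arcs (interaction_graph V f)"
proof -
  have "\<exists>w\<in>configs V. \<not> w j \<and> sgn (of_bool (f (flip w j) i) - of_bool (f w i)) = \<sigma> j * \<sigma> i"
  proof (cases "y j")
    case True
    with assms show ?thesis by (intro bexI[of _ z]) (auto simp: \<sigma>_def)
  next
    case False
    \<comment> \<open>Arcs are read off where component \<open>j\<close> is 0, here at
      \<open>flip z j\<close>. The change of component \<open>i\<close> of \<open>f\<close> is thus
      taken against the move towards \<open>y\<close>, which accounts for the factor
      \<open>\<sigma> j = -1\<close>.\<close>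
    with assms show ?thesis
      by (intro bexI[of _ "flip z j"] flip_in_configs) (auto simp: \<sigma>_def, auto simp: flip_def)
  qed
  then show ?thesis using assms(2,3) by (auto simp: interaction_graph_def \<sigma>_def)
qed

lemma positive_fvs_distinguishes_trap_sets:
  assumes G: "signed_digraph G" and f: "f \<in> BNs_on G" and I: "positive_fvs G I"
    and A: "trap_set (verts G) f A" and B: "trap_set (verts G) f B" and disj: "A \<inter> B = {}"
    and a: "a \<in> A" and b: "b \<in> B"
  shows "\<exists>i\<in>I. a i \<noteq> b i"
proof (rule ccontr)
  define V where "V = verts G"
  define diff where "diff x y = {k. x k \<noteq> y k}" for x y :: "'a \<Rightarrow> bool"
  define R where "R = (\<lambda>(x, y). x \<in> A \<and> y \<in> B \<and> (\<forall>i\<in>I. x i = y i))"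
  have finV: "finite V" using G by (simp add: signed_digraph_def V_def)
  assume "\<not> (\<exists>i\<in>I. a i \<noteq> b i)"
  with a b have "R (a, b)" by (auto simp: R_def)
  then obtain q where "R q" and
    min: "\<And>q'. R q' \<Longrightarrow> card (diff (fst q) (snd q)) \<le> card (diff (fst q') (snd q'))"
    using ex_has_least_nat[of R "(a, b)" "\<lambda>q. card (diff (fst q) (snd q))"] by blast
  obtain x y where q: "q = (x, y)" by (cases q)
  have xy: "x \<in> A" "y \<in> B" and agree: "\<And>i. i \<in> I \<Longrightarrow> x i = y i"
    using \<open>R q\<close> by (auto simp: R_def q)
  have conf: "x \<in> configs V" "y \<in> configs V" using xy A B by (auto simp: trap_set_def V_def)
  define D where "D = diff x y"
  \<comment> \<open>Outside \<open>V\<close> both configurations take the value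
    \<open>undefined\<close>, so they cannot differ there.\<close>
  have DV: "D \<subseteq> V - I" using conf agree by (auto simp: D_def diff_def configs_iff)
  then have finD: "finite D" using finV finite_subset by blast
  have "x \<noteq> y" using xy disj by auto
  then have D_ne: "D \<noteq> {}" by (auto simp: D_def diff_def fun_eq_iff)
  have closer: "\<not> R (x', y')" if "diff x' y' = D - {i}" "i \<in> D" for x' y' i
    using min[of "(x', y')"] that finD card_Diff1_less[OF finD that(2)] by (auto simp: q D_def)
  have fixed: "f x i = x i \<and> f y i = y i" if i: "i \<in> D" for i
  proof (rule ccontr)
    \<comment> \<open>As \<open>i\<close> is outside \<open>I\<close>, flipping it keeps the
      agreement on \<open>I\<close> while removing \<open>i\<close> from the difference set.\<close>
    have iVI: "i \<in> V" "i \<notin> I" using i DV by auto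
    assume "\<not> (f x i = x i \<and> f y i = y i)"
    then consider "f x i \<noteq> x i" | "f y i \<noteq> y i" by blast
    then show False
    proof cases
      case 1
      then have "flip x i \<in> A" using trap_set_flip[OF A xy(1)] iVI by (simp add: V_def)
      then have "R (flip x i, y)" using xy agree iVI by (auto simp: R_def flip_def)
      moreover have "diff (flip x i) y = D - {i}" using i by (auto simp: D_def diff_def flip_def)
      ultimately show False using closer i by blast
    next
      case 2
      then have "flip y i \<in> B" using trap_set_flip[OF B xy(2)] iVI by (simp add: V_def)
      then have "R (x, flip y i)" using xy agree iVI by (auto simp: R_def flip_def)
      moreover have "diff x (flip y i) = D - {i}" using i by (auto simp: D_def diff_def flip_def)
      ultimately show False using closer i by blast
    qed
  qed
  define \<sigma> :: "'a \<Rightarrow> int" where "\<sigma> = (\<lambda>k. if y k then 1 else -1)"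
  have "\<exists>j\<in>D. (j, i, \<sigma> j * \<sigma> i) \<in> arcs G" if i: "i \<in> D" for i
  proof -
    have neq: "f x i \<noteq> f y i" using fixed[OF i] i by (simp add: D_def diff_def)
    have "\<And>k. k \<notin> D \<Longrightarrow> x k = y k" by (simp add: D_def diff_def)
    from exists_critical_flip[where P = "\<lambda>z. f z i", OF finD this neq]
    obtain z j where z: "j \<in> D" "x j \<noteq> y j" "z j = x j" "\<forall>k. k \<notin> D \<longrightarrow> z k = x k"
      "f z i = f x i" "f (flip z j) i = f y i" by blast
    have "z \<in> configs V" using z(4) conf(1) DV by (auto simp: configs_iff)
    then have "(j, i, \<sigma> j * \<sigma> i) \<in> arcs (interaction_graph V f)"
      unfolding \<sigma>_def using z i DV neq fixed[OF i] by (intro interaction_arc_of_flip) auto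
    with z(1) f show ?thesis by (auto simp: BNs_on_def V_def)
  qed
  moreover have "\<sigma> k * \<sigma> k = 1" for k by (simp add: \<sigma>_def)
  moreover have "D \<subseteq> verts G" using DV by (auto simp: V_def)
  ultimately obtain p where "positive_cycle (G \<restriction> D) p"
    using exists_positive_cycle_if_balanced[OF G _ D_ne, of \<sigma>] by blast
  from positive_cycle_induced_mono[OF DV this] I show False
    by (auto simp: positive_fvs_def V_def)
qed

lemma exists_minimum_positive_fvs:
  assumes "signed_digraph G"
  shows "\<exists>I. positive_fvs G I \<and> card I = positive_feedback_number G"
proof -
  have "{I. positive_fvs G I} \<subseteq> Pow (verts G)" by (auto simp: positive_fvs_def)
  then have "finite {I. positive_fvs G I}"
    using assms by (auto simp: signed_digraph_def intro: finite_subset)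
  \<comment> \<open>The full vertex set is a feedback set, so the minimum is over a nonempty finite
    set and is attained.\<close>
  then have "Min (card ` {I. positive_fvs G I}) \<in> card ` {I. positive_fvs G I}"
    using positive_fvs_verts by (intro Min_in) auto
  then show ?thesis by (auto simp: positive_feedback_number_def)
qed

lemma spanned_subspace_const:
  assumes "X \<subseteq> configs V" "i \<in> V" "\<And>x. x \<in> X \<Longrightarrow> x i = c" "z \<in> spanned_subspace V X"
  shows "z i = c"
proof -
  have "config_subspace V {x \<in> configs V. x i = c}"
    unfolding config_subspace_def using assms(2) by (intro exI[of _ "{i}"] exI[of _ "\<lambda>_. c"]) auto
  moreover have "X \<subseteq> {x \<in> configs V. x i = c}" using assms(1,3) by auto
  ultimately have "spanned_subspace V X \<subseteq> {x \<in> configs V. x i = c}"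
    unfolding spanned_subspace_def by (intro hull_minimal)
  with assms(4) show ?thesis by auto
qed

theorem theorem24:
  fixes G :: "'v sdigraph"
  assumes "signed_digraph G"
    and "positive_feedback_number G \<le> 1"
  shows "separating G"
  unfolding separating_def
proof (intro ballI allI impI, elim conjE)
  fix f A B
  assume f: "f \<in> BNs_on G" and att: "attractor (verts G) f A" "attractor (verts G) f B"
    and "A \<noteq> B"
  then have disj: "A \<inter> B = {}" by (intro attractors_disjoint)
  have trap: "trap_set (verts G) f A" "trap_set (verts G) f B"
    using att by (auto simp: attractor_def)
  then have sub: "A \<subseteq> configs (verts G)" "B \<subseteq> configs (verts G)"
    by (auto simp: trap_set_def)
  obtain I where I: "positive_fvs G I" "card I \<le> 1"
    using exists_minimum_positive_fvs[OF assms(1)] assms(2) by auto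
  have differ: "\<exists>i\<in>I. x i \<noteq> y i" if "x \<in> A" "y \<in> B" for x y
    using positive_fvs_distinguishes_trap_sets[OF assms(1) f I(1) trap disj that] .
  obtain a b where ab: "a \<in> A" "b \<in> B" using trap by (auto simp: trap_set_def)
  have "I \<subseteq> verts G" using I(1) by (simp add: positive_fvs_def)
  moreover from this have "finite I"
    using assms(1) by (auto simp: signed_digraph_def intro: finite_subset)
  \<comment> \<open>An empty \<open>I\<close> could not distinguish \<open>a\<close> from
    \<open>b\<close>, so \<open>I\<close> is a singleton.\<close>
  moreover obtain i where "i \<in> I" using differ[OF ab] by auto
  ultimately have i: "I = {i}" "i \<in> verts G"
    using I(2) card_le_Suc0_iff_eq[of I] by auto
  \<comment> \<open>Both \<open>x i\<close> and \<open>a i\<close> differ from \<open>b i\<close>,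
    and there are only two values.\<close>
  have "x i = a i" if "x \<in> A" for x using differ[OF that ab(2)] differ[OF ab] i by auto
  moreover have "y i = (\<not> a i)" if "y \<in> B" for y using differ[OF ab(1) that] i by auto
  ultimately have "z i = a i" "w i = (\<not> a i)"
    if "z \<in> spanned_subspace (verts G) A" "w \<in> spanned_subspace (verts G) B" for z w
    using spanned_subspace_const[OF _ i(2)] sub that by metis+
  then show "spanned_subspace (verts G) A \<inter> spanned_subspace (verts G) B = {}" by blast
qed

end
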